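(* Let $n,m\in\mathbb{N}$, $t_0\in\mathbb{N}$, and let $\{W(t)\}$ be a sequence of random $n\times n$ matrices adapted to a filtration $\{\mathcal{F}(t)\}$, with $W(t)$ row-stochastic almost surely for all $t\ge t_0$. Fix $\gamma\in(0,1)$ and assume that for all $t\ge t_0$: (a) every node of $\mathcal{G}(W(t))$ has a self-loop almost surely; (b) there is an integer $B>0$, independent of $t$, such that the random graph $([n],\mathcal{E}_B(t))$ with $\mathcal{E}_B(t)=\bigcup_{\tau=tB+1}^{(t+1)B}\mathcal{E}(\mathbb{E}[W(\tau)\mid\mathcal{F}(tB)])$ has a spanning rooted tree almost surely. Let $\mathbf{x}(t_0)\in(\mathbb{R}^m)^n$, let $\{\mathbf{u}(t)\}_{t\ge t_0}$ be a sequence of random vectors in $(\mathbb{R}^m)^n$, and let $\mathbf{x}(t+1)=W(t+1)\mathbf{x}(t)+\mathbf{u}(t)$ for $t\ge t_0$. Let $\tilde\beta>0$. If, for some $q\ge0$, $d(\mathbf{u}(t))<q\,t^{-\tilde\beta}$ almost surely for all $t\ge t_0$, then for every $\beta<\tilde\beta$, $\lim_{t\to\infty}d(\mathbf{x}(t))\,t^{\beta}=0$ almost surely.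
   Context: $[n]=\{1,\dots,n\}$. A filtration is an increasing sequence of sigma-algebras $\mathcal{F}(0)\subseteq\mathcal{F}(1)\subseteq\cdots$; adapted means $W(t)$ is $\mathcal{F}(t)$-measurable for every $t$. For an $n\times n$ matrix $A=[a_{ij}]$, $\mathcal{G}(A)=([n],\mathcal{E}(A))$ is the directed graph with edge set $\mathcal{E}(A)=\{(j,i): i,j\in[n],\ a_{ij}>\gamma\}$. A directed graph on $[n]$ has a spanning rooted tree if there is a vertex $r$ from which there is a directed path to every other vertex. An element $\mathbf{x}\in(\mathbb{R}^m)^n$ is a vector of $n$ entries $\mathbf{x}_i\in\mathbb{R}^m$; for an $n\times n$ matrix $A$, $[A\mathbf{x}]_i=\sum_{j=1}^n a_{ij}\mathbf{x}_j$. $\|\cdot\|$ is the $\ell_\infty$ norm on $\mathbb{R}^m$ and $d(\mathbf{x})=\max_{i,j\in[n]}\|\mathbf{x}_i-\mathbf{x}_j\|$. *)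

theory Defs
  imports "HOL-Probability.Probability"
begin

definition row_stochastic :: "real^'n^'n \<Rightarrow> bool" where
  "row_stochastic A \<longleftrightarrow> (\<forall>i j. A $ i $ j \<ge> 0) \<and> (\<forall>i. (\<Sum>j\<in>UNIV. A $ i $ j) = 1)"

text \<open>Edges point from the column index to the row index: \<open>(j, i)\<close> means that \<open>i\<close> is
  influenced by \<open>j\<close>.\<close>

definition edges :: "real \<Rightarrow> real^'n^'n \<Rightarrow> ('n \<times> 'n) set" where
  "edges \<gamma> A = {(j, i). A $ i $ j > \<gamma>}"

definition has_spanning_rooted_tree :: "('n \<times> 'n) set \<Rightarrow> bool" where
  "has_spanning_rooted_tree E \<longleftrightarrow> (\<exists>r. \<forall>v. v \<noteq> r \<longrightarrow> (r, v) \<in> E\<^sup>+)"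

definition mat_cond_exp ::
    "'w measure \<Rightarrow> 'w measure \<Rightarrow> ('w \<Rightarrow> real^'n^'n) \<Rightarrow> 'w \<Rightarrow> real^'n^'n" where
  "mat_cond_exp M G A \<omega> = (\<chi> i j. real_cond_exp M G (\<lambda>\<omega>'. A \<omega>' $ i $ j) \<omega>)"

definition block_edges ::
    "real \<Rightarrow> 'w measure \<Rightarrow> (nat \<Rightarrow> 'w measure) \<Rightarrow> (nat \<Rightarrow> 'w \<Rightarrow> real^'n^'n) \<Rightarrow>
     nat \<Rightarrow> nat \<Rightarrow> 'w \<Rightarrow> ('n \<times> 'n) set" where
  "block_edges \<gamma> M F W B t \<omega> =
     (\<Union>\<tau>\<in>{t * B + 1..(t + 1) * B}. edges \<gamma> (mat_cond_exp M (F (t * B)) (W \<tau>) \<omega>))"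

text \<open>An element of $(\mathbb{R}^m)^n$ is rendered as \<open>x :: real^'m^'n\<close>, so that \<open>x $ i\<close> is its
  \<open>i\<close>-th entry; \<open>infnorm\<close> is the maximum norm on \<open>real^'m\<close>.\<close>

definition diam :: "real^'m^'n \<Rightarrow> real" where
  "diam x = (MAX (i, j)\<in>UNIV. infnorm (x $ i - x $ j))"

text \<open>The action of a matrix on \<open>real^'m^'n\<close> is matrix multiplication.\<close>

lemma matrix_action_nth:
  fixes A :: "real^'n^'n" and x :: "real^'m^'n"
  shows "(A ** x) $ i = (\<Sum>j\<in>UNIV. A $ i $ j *\<^sub>R x $ j)"
  by (simp add: vec_eq_iff matrix_matrix_mult_def)

end

theory Submission
  imports Defs
begin

text \<open>Call an entry of the product of \<open>k\<close> consecutive blocks large if it is at least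
  \<open>\<epsilon> ^ k\<close>. Unless some column is entirely large, the root of the conditional expectation graph
  of the next block has an edge leaving its own column; the corresponding matrix entry is at
  least \<open>\<epsilon>\<close> with conditional probability at least \<open>\<epsilon>\<close>, and then one more entry becomes
  large. So after \<open>n\<^sup>2\<close> blocks some column is large with conditional probability bounded below,
  and the diameter contracts by a fixed factor. The diameters along these superblocks are
  dominated by a recursion \<open>y (j + 1) = \<lambda> j * y j + e j\<close> with \<open>e j\<close> of order \<open>j powr (- \<beta>')\<close> and
  \<open>\<lambda> j\<close> contracting in conditional expectation. The \<open>p\<close>-th moments of \<open>y j\<close> are of order
  \<open>j powr (- p * \<beta>')\<close>, so for \<open>p * (\<beta>' - \<beta>) > 1\<close> the moments of \<open>j powr \<beta> * y j\<close> are
  summable and \<open>j powr \<beta> * y j\<close> tends to 0 almost surely.\<close>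

subsection \<open>Stochastic matrices and the diameter\<close>

text \<open>Under the maximum norm the diameter can be bounded one coordinate at a time, which
  reduces the triangle inequality and the contraction estimate to statements about real
  numbers.\<close>

lemma diam_le_iff:
  fixes x :: "real^'m^'n"
  shows "diam x \<le> D \<longleftrightarrow> (\<forall>i j k. \<bar>x $ i $ k - x $ j $ k\<bar> \<le> D)"
proof -
  have infnorm_le: "infnorm v \<le> D \<longleftrightarrow> (\<forall>k. \<bar>v $ k\<bar> \<le> D)" for v :: "real^'m"
    by (auto simp: infnorm_Max Basis_vec_def inner_axis)
  show ?thesis
    unfolding diam_def by (auto simp: infnorm_le)
qed

lemma diam_component_le: "\<bar>x $ i $ k - x $ j $ k\<bar> \<le> diam x"
  using diam_le_iff[of x "diam x"] by simp

lemma diam_nonneg: "0 \<le> diam x"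
  using diam_component_le[of x undefined undefined undefined] by simp

lemma diam_add: "diam (x + y) \<le> diam x + diam y"
  unfolding diam_le_iff
proof (intro allI)
  fix i j k
  show "\<bar>(x + y) $ i $ k - (x + y) $ j $ k\<bar> \<le> diam x + diam y"
    using diam_component_le[of x i k j] diam_component_le[of y i k j] by simp
qed

text \<open>Moving the weight \<open>\<eta>\<close> of column \<open>c\<close> to one side leaves two averages of total
  weight \<open>1 - \<eta>\<close> in the two rows; the common part \<open>\<eta> * x $ c\<close> cancels.\<close>

lemma diam_matrix_mult_le:
  fixes A :: "real^'n^'n" and x :: "real^'m^'n"
  assumes A: "row_stochastic A" and col: "\<And>i. \<eta> \<le> A $ i $ c" and "0 \<le> \<eta>"
  shows "diam (A ** x) \<le> (1 - \<eta>) * diam x"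
proof -
  have le: "(A ** x) $ i $ k - (A ** x) $ j $ k \<le> (1 - \<eta>) * diam x" for i j k
  proof -
    define w where "w i l = A $ i $ l - (if l = c then \<eta> else 0)" for i l
    define X where "X = Max (range (\<lambda>l. x $ l $ k))"
    define Y where "Y = Min (range (\<lambda>l. x $ l $ k))"
    have w_nonneg: "0 \<le> w i l" for i l
      using A col[of i] by (auto simp: w_def row_stochastic_def)
    have w_sum: "(\<Sum>l\<in>UNIV. w i l) = 1 - \<eta>" for i
      using A by (simp add: w_def row_stochastic_def sum_subtractf)
    have split: "(A ** x) $ i $ k = \<eta> * x $ c $ k + (\<Sum>l\<in>UNIV. w i l * x $ l $ k)" for i
    proof -
      have "(\<Sum>l\<in>UNIV. w i l * x $ l $ k)
          = (\<Sum>l\<in>UNIV. A $ i $ l * x $ l $ k - (if l = c then \<eta> * x $ c $ k else 0))"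
        by (rule sum.cong) (auto simp: w_def algebra_simps)
      then show ?thesis
        by (simp add: matrix_matrix_mult_def sum_subtractf)
    qed
    have "(\<Sum>l\<in>UNIV. w i l * x $ l $ k) \<le> (\<Sum>l\<in>UNIV. w i l * X)"
      unfolding X_def by (intro sum_mono mult_left_mono w_nonneg Max_ge) auto
    also have "\<dots> = (1 - \<eta>) * X" by (simp add: w_sum flip: sum_distrib_right)
    finally have upper: "(\<Sum>l\<in>UNIV. w i l * x $ l $ k) \<le> (1 - \<eta>) * X" .
    have "(\<Sum>l\<in>UNIV. w j l * Y) \<le> (\<Sum>l\<in>UNIV. w j l * x $ l $ k)"
      unfolding Y_def by (intro sum_mono mult_left_mono w_nonneg Min_le) auto
    then have lower: "(1 - \<eta>) * Y \<le> (\<Sum>l\<in>UNIV. w j l * x $ l $ k)"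
      by (simp add: w_sum flip: sum_distrib_right)
    have "X \<in> range (\<lambda>l. x $ l $ k)" "Y \<in> range (\<lambda>l. x $ l $ k)"
      unfolding X_def Y_def by (auto intro!: Max_in Min_in)
    then obtain a b where "X = x $ a $ k" "Y = x $ b $ k" by auto
    then have "X - Y \<le> diam x"
      using diam_component_le[of x a k b] by simp
    moreover have "0 \<le> 1 - \<eta>"
      using w_sum[of i] sum_nonneg[of UNIV "w i"] w_nonneg[of i] by simp
    ultimately have "(1 - \<eta>) * (X - Y) \<le> (1 - \<eta>) * diam x"
      by (rule mult_left_mono)
    then show ?thesis
      using upper lower by (simp add: split algebra_simps)
  qed
  show ?thesis
    unfolding diam_le_iff by (intro allI abs_leI) (use le in \<open>auto simp: algebra_simps\<close>)
qed

lemma diam_row_stochastic_mult_le: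
  assumes "row_stochastic A"
  shows "diam (A ** x) \<le> diam x"
  using diam_matrix_mult_le[of A 0 undefined x] assms by (simp add: row_stochastic_def)

section \<open>Products of row-stochastic matrices\<close>

lemma row_stochastic_mat_1: "row_stochastic (mat 1)"
  by (auto simp: row_stochastic_def mat_def)

lemma matrix_mult_entry_ge:
  fixes A P :: "real^'n^'n"
  assumes "row_stochastic A" "row_stochastic P"
  shows "A $ i $ l * P $ l $ j \<le> (A ** P) $ i $ j"
  using assms unfolding matrix_matrix_mult_def row_stochastic_def
  by (auto intro!: member_le_sum[of l UNIV "\<lambda>l. A $ i $ l * P $ l $ j"])

lemma row_stochastic_mult:
  fixes A P :: "real^'n^'n"
  assumes A: "row_stochastic A" and P: "row_stochastic P"
  shows "row_stochastic (A ** P)"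
proof -
  have "(\<Sum>j\<in>UNIV. (A ** P) $ i $ j) = 1" for i
  proof -
    have "(\<Sum>j\<in>UNIV. (A ** P) $ i $ j) = (\<Sum>j\<in>UNIV. \<Sum>l\<in>UNIV. A $ i $ l * P $ l $ j)"
      by (simp add: matrix_matrix_mult_def)
    also have "\<dots> = (\<Sum>l\<in>UNIV. A $ i $ l * (\<Sum>j\<in>UNIV. P $ l $ j))"
      unfolding sum_distrib_left by (rule sum.swap)
    finally show ?thesis
      using A P by (simp add: row_stochastic_def)
  qed
  moreover have "0 \<le> (A ** P) $ i $ j" for i j
    using A P by (auto simp: matrix_matrix_mult_def row_stochastic_def intro!: sum_nonneg)
  ultimately show ?thesis by (auto simp: row_stochastic_def)
qed

lemma row_stochastic_le_1:
  assumes "row_stochastic A"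
  shows "A $ i $ j \<le> 1"
  using assms member_le_sum[of j UNIV "\<lambda>j. A $ i $ j"] by (simp add: row_stochastic_def)

text \<open>Later factors act from the left and the first one is \<open>A (Suc a)\<close>: this is
  the transition matrix of the unperturbed recursion from time \<open>a\<close> to time
  \<open>a + k\<close>.\<close>

primrec left_prod :: "(nat \<Rightarrow> real^'n^'n) \<Rightarrow> nat \<Rightarrow> nat \<Rightarrow> real^'n^'n" where
  "left_prod A a 0 = mat 1"
| "left_prod A a (Suc k) = A (Suc (a + k)) ** left_prod A a k"

lemma left_prod_add: "left_prod A a (k + l) = left_prod A (a + k) l ** left_prod A a k"
  by (induction l) (simp_all add: matrix_mul_assoc add.assoc)

lemma row_stochastic_left_prod:
  assumes "\<And>t. a < t \<Longrightarrow> row_stochastic (A t)"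
  shows "row_stochastic (left_prod A a k)"
  by (induction k) (auto intro!: row_stochastic_mult row_stochastic_mat_1 assms)

lemma left_prod_diag_ge:
  assumes A: "\<And>t. a < t \<Longrightarrow> row_stochastic (A t)"
    and diag: "\<And>t i. a < t \<Longrightarrow> \<gamma> \<le> A t $ i $ i" and "0 \<le> \<gamma>"
  shows "\<gamma> ^ k \<le> left_prod A a k $ i $ i"
proof (induction k)
  case 0
  then show ?case by (simp add: mat_def)
next
  case (Suc k)
  have "\<gamma> * \<gamma> ^ k \<le> A (Suc (a + k)) $ i $ i * left_prod A a k $ i $ i"
    using Suc A[of "Suc (a + k)"] diag[of "Suc (a + k)" i] \<open>0 \<le> \<gamma>\<close>
    by (intro mult_mono) (auto simp: row_stochastic_def)
  also have "\<dots> \<le> left_prod A a (Suc k) $ i $ i"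
    unfolding left_prod.simps
    by (intro matrix_mult_entry_ge row_stochastic_left_prod A) auto
  finally show ?case by simp
qed

text \<open>Stay at \<open>j\<close> before time \<open>\<tau>\<close>, move to \<open>i\<close> at
  time \<open>\<tau>\<close>, and stay at \<open>i\<close> afterwards. The waiting steps cost one
  factor \<open>\<gamma>\<close> each; one more factor is given away so that the exponent is
  \<open>k\<close> wherever \<open>\<tau>\<close> lies.\<close>

lemma left_prod_entry_ge:
  assumes A: "\<And>t. a < t \<Longrightarrow> row_stochastic (A t)"
    and diag: "\<And>t i. a < t \<Longrightarrow> \<gamma> \<le> A t $ i $ i" and "0 \<le> \<gamma>" "\<gamma> \<le> 1"
    and \<tau>: "a < \<tau>" "\<tau> \<le> a + k"
  shows "\<gamma> ^ k * A \<tau> $ i $ j \<le> left_prod A a k $ i $ j"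
  using \<tau>(2)
proof (induction k)
  case 0
  then show ?case using \<tau>(1) by simp
next
  case (Suc k)
  let ?A = "A (Suc (a + k))" and ?P = "left_prod A a k"
  have rs: "row_stochastic ?A" "row_stochastic ?P" "0 \<le> A \<tau> $ i $ j" "0 \<le> ?A $ i $ i" "0 \<le> ?A $ i $ j"
    using A A[OF \<tau>(1)] A[of "Suc (a + k)"]
    by (auto intro!: row_stochastic_left_prod) (auto simp: row_stochastic_def)
  show ?case
  proof (cases "\<tau> = Suc (a + k)")
    case True
    have "\<gamma> ^ Suc k * ?A $ i $ j \<le> ?A $ i $ j * \<gamma> ^ k"
      using mult_left_le_one_le[of "?A $ i $ j * \<gamma> ^ k" \<gamma>] rs(5) assms(3,4)
      by (simp add: mult_ac)
    also have "\<dots> \<le> ?A $ i $ j * ?P $ j $ j"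
      by (intro mult_left_mono left_prod_diag_ge assms rs)
    also have "\<dots> \<le> left_prod A a (Suc k) $ i $ j"
      unfolding left_prod.simps by (rule matrix_mult_entry_ge[OF rs(1,2)])
    finally show ?thesis using True by simp
  next
    case False
    then have "\<gamma> * (\<gamma> ^ k * A \<tau> $ i $ j) \<le> ?A $ i $ i * ?P $ i $ j"
      using Suc diag[of "Suc (a + k)" i] rs assms(3) by (intro mult_mono) auto
    also have "\<dots> \<le> left_prod A a (Suc k) $ i $ j"
      unfolding left_prod.simps by (rule matrix_mult_entry_ge[OF rs(1,2)])
    finally show ?thesis by (simp add: mult.assoc)
  qed
qed

text \<open>The induction carries the accumulated perturbation \<open>r\<close> as a vector, not
  only its diameter, so that the full product still acts on \<open>x a\<close> and can contract
  later. Row-stochastic factors do not enlarge the diameter of \<open>r\<close>, hence the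
  perturbations merely add up.\<close>

lemma diam_perturbed_le:
  assumes A: "\<And>t. a < t \<Longrightarrow> row_stochastic (A t)"
    and step: "\<And>t. a \<le> t \<Longrightarrow> x (Suc t) = A (Suc t) ** x t + u t"
  shows "diam (x (a + k)) \<le> diam (left_prod A a k ** x a) + (\<Sum>l<k. diam (u (a + l)))"
proof -
  have "\<exists>r. x (a + k) = left_prod A a k ** x a + r \<and> diam r \<le> (\<Sum>l<k. diam (u (a + l)))"
  proof (induction k)
    case 0
    have "diam 0 \<le> 0" by (simp add: diam_le_iff)
    then show ?case by (auto intro!: exI[of _ 0])
  next
    case (Suc k)
    then obtain r where r: "x (a + k) = left_prod A a k ** x a + r"
      "diam r \<le> (\<Sum>l<k. diam (u (a + l)))" by blast
    let ?r = "A (Suc (a + k)) ** r + u (a + k)"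
    have "x (a + Suc k) = left_prod A a (Suc k) ** x a + ?r"
      using step[of "a + k"] by (simp add: r(1) matrix_add_ldistrib matrix_mul_assoc)
    moreover have "diam ?r \<le> diam r + diam (u (a + k))"
      using diam_add[of "A (Suc (a + k)) ** r" "u (a + k)"]
        diam_row_stochastic_mult_le[OF A[of "Suc (a + k)"], of r] by simp
    ultimately show ?case using r(2) by (intro exI[of _ ?r]) auto
  qed
  then obtain r where "x (a + k) = left_prod A a k ** x a + r"
    "diam r \<le> (\<Sum>l<k. diam (u (a + l)))" by blast
  then show ?thesis
    using diam_add[of "left_prod A a k ** x a" r] by simp
qed

subsection \<open>Spreading of influence\<close>

text \<open>The pairs are (row, column), the reverse of the order in \<open>edges\<close>:
  \<open>(i, c)\<close> records that \<open>i\<close> is influenced by \<open>c\<close>.\<close>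

definition large_entries :: "real \<Rightarrow> real^'n^'n \<Rightarrow> ('n \<times> 'n) set" where
  "large_entries \<eta> P = {(i, c). \<eta> \<le> P $ i $ c}"

text \<open>A measure of progress after \<open>k\<close> blocks. The diagonal supplies the initial
  \<open>CARD('n)\<close> pairs, and every successful block adds one. Once a column is full no
  further growth is guaranteed, hence the disjunction.\<close>

definition spread :: "nat \<Rightarrow> ('n::finite \<times> 'n) set \<Rightarrow> bool" where
  "spread k S \<longleftrightarrow>
     (\<forall>i. (i, i) \<in> S) \<and> (CARD('n) + k \<le> card S \<or> (\<exists>c. \<forall>i. (i, c) \<in> S))"

lemma spread_mat_1: "spread 0 (large_entries 1 (mat 1 :: real^'n^'n))"
proof -
  have "large_entries 1 (mat 1 :: real^'n^'n) = range (\<lambda>i. (i, i))"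
    by (auto simp: large_entries_def mat_def split: if_splits)
  moreover have "card (range (\<lambda>i::'n. (i, i))) = CARD('n)"
    by (rule card_image) (auto simp: inj_on_def)
  ultimately show ?thesis by (auto simp: spread_def)
qed

text \<open>The counting alternative would require more pairs than exist.\<close>

lemma spread_full_column:
  fixes S :: "('n::finite \<times> 'n) set"
  assumes "spread (CARD('n) * CARD('n)) S"
  shows "\<exists>c. \<forall>i. (i, c) \<in> S"
proof -
  have "card S \<le> card (UNIV :: ('n \<times> 'n) set)"
    by (intro card_mono) auto
  also have "\<dots> < CARD('n) + CARD('n) * CARD('n)"
    by (simp add: card_cartesian_product flip: UNIV_Times_UNIV)
  finally show ?thesis using assms by (auto simp: spread_def)
qed

lemma large_entries_mult:
  fixes A P :: "real^'n^'n"
  assumes rs: "row_stochastic A" "row_stochastic P" and "0 \<le> \<epsilon>" "0 \<le> \<eta>"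
    and "\<epsilon> \<le> A $ b $ a" "(a, c) \<in> large_entries \<eta> P"
  shows "(b, c) \<in> large_entries (\<epsilon> * \<eta>) (A ** P)"
proof -
  have "\<epsilon> * \<eta> \<le> A $ b $ a * P $ a $ c"
    using assms by (intro mult_mono) (auto simp: large_entries_def row_stochastic_def)
  also have "\<dots> \<le> (A ** P) $ b $ c" by (rule matrix_mult_entry_ge[OF rs])
  finally show ?thesis by (simp add: large_entries_def)
qed

text \<open>The diagonal of \<open>A\<close> keeps each large entry large at the lowered threshold,
  so a full column stays full.\<close>

lemma spread_mult_full_column:
  fixes A P :: "real^'n^'n"
  assumes rs: "row_stochastic A" "row_stochastic P" and eps: "0 \<le> \<epsilon>" "0 \<le> \<eta>"
    and diag: "\<And>i. \<epsilon> \<le> A $ i $ i"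
    and spr: "spread k (large_entries \<eta> P)" and col: "\<forall>i. (i, c) \<in> large_entries \<eta> P"
  shows "spread (Suc k) (large_entries (\<epsilon> * \<eta>) (A ** P))"
  using spr col large_entries_mult[OF rs eps diag] unfolding spread_def by blast

text \<open>The old large entries survive through the diagonal of \<open>A\<close>, and
  \<open>(b, c)\<close> joins them by the route from \<open>c\<close> through \<open>a\<close> to
  \<open>b\<close>.\<close>

lemma spread_mult_edge:
  fixes A P :: "real^'n^'n"
  assumes rs: "row_stochastic A" "row_stochastic P" and eps: "0 \<le> \<epsilon>" "0 \<le> \<eta>"
    and diag: "\<And>i. \<epsilon> \<le> A $ i $ i"
    and spr: "spread k (large_entries \<eta> P)" and edge: "\<epsilon> \<le> A $ b $ a"
    and new: "(a, c) \<in> large_entries \<eta> P" "(b, c) \<notin> large_entries \<eta> P"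
  shows "spread (Suc k) (large_entries (\<epsilon> * \<eta>) (A ** P))"
proof (cases "\<exists>c. \<forall>i. (i, c) \<in> large_entries \<eta> P")
  case True
  then show ?thesis using spread_mult_full_column[OF rs eps diag spr] by blast
next
  case False
  let ?S = "large_entries \<eta> P" and ?S' = "large_entries (\<epsilon> * \<eta>) (A ** P)"
  have "insert (b, c) ?S \<subseteq> ?S'"
    using large_entries_mult[OF rs eps diag] large_entries_mult[OF rs eps edge new(1)] by auto
  then have "card (insert (b, c) ?S) \<le> card ?S'"
    by (intro card_mono) auto
  then have "Suc (card ?S) \<le> card ?S'" using new(2) by simp
  moreover have "CARD('n) + k \<le> card ?S" using spr False by (auto simp: spread_def)
  moreover have "(i, i) \<in> ?S'" for i
    using spr large_entries_mult[OF rs eps diag] by (auto simp: spread_def)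
  ultimately show ?thesis by (auto simp: spread_def)
qed

text \<open>A root \<open>r\<close> belongs to its own column, so some edge leaves that column unless it is full.\<close>

lemma spread_obtains_edge:
  assumes "has_spanning_rooted_tree E" "spread k S" "\<nexists>c. \<forall>i. (i, c) \<in> S"
  obtains a b c where "(a, b) \<in> E" "(a, c) \<in> S" "(b, c) \<notin> S"
proof -
  obtain r where r: "\<And>v. v \<noteq> r \<Longrightarrow> (r, v) \<in> E\<^sup>+"
    using assms(1) by (auto simp: has_spanning_rooted_tree_def)
  obtain v where v: "(v, r) \<notin> S" using assms(3) by blast
  have rr: "(r, r) \<in> S" using assms(2) by (auto simp: spread_def)
  show ?thesis
  proof (rule ccontr)
    assume "\<not> thesis"
    then have closed: "\<And>a b. (a, b) \<in> E \<Longrightarrow> (a, r) \<in> S \<Longrightarrow> (b, r) \<in> S"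
      using that by blast
    have "(r, w) \<in> E\<^sup>+ \<Longrightarrow> (w, r) \<in> S" for w
      by (induction rule: trancl_induct) (use closed rr in blast)+
    then show False using r v rr by metis
  qed
qed

subsection \<open>Moments of contracting random recursions\<close>

text \<open>After shifting the start to \<open>N\<close>, summing the recursion bounds a partial sum
  \<open>S\<close> by \<open>c 0 + \<sigma> * S + suminf g\<close>, where \<open>g\<close> is the
  shifted \<open>f\<close>. Solving for \<open>S\<close> gives a bound independent of the number of
  terms.\<close>

lemma summable_of_contraction:
  fixes b f :: "nat \<Rightarrow> real"
  assumes nonneg: "\<And>k. 0 \<le> b k" "\<And>k. 0 \<le> f k" and "summable f" and "\<sigma> < 1"
    and step: "\<And>k. N \<le> k \<Longrightarrow> b (Suc k) \<le> \<sigma> * b k + f k"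
  shows "summable b"
proof -
  define c where "c k = b (k + N)" for k
  define g where "g k = f (k + N)" for k
  have "summable g" using \<open>summable f\<close> by (simp add: g_def[abs_def] summable_iff_shift)
  have c_nonneg: "0 \<le> c k" for k by (simp add: c_def nonneg)
  have g_nonneg: "0 \<le> g k" for k by (simp add: g_def nonneg)
  have c_step: "c (Suc k) \<le> \<sigma> * c k + g k" for k
    using step[of "k + N"] by (simp add: c_def g_def)
  have "(\<Sum>k<n. c k) \<le> (c 0 + suminf g) / (1 - \<sigma>)" for n
  proof -
    have "(\<Sum>k<n. c k) \<le> (\<Sum>k<Suc n. c k)"
      using c_nonneg by simp
    also have "\<dots> = c 0 + (\<Sum>k<n. c (Suc k))"
      by (rule sum.lessThan_Suc_shift)
    also have "\<dots> \<le> c 0 + (\<Sum>k<n. \<sigma> * c k + g k)"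
      by (intro add_left_mono sum_mono c_step)
    also have "\<dots> = c 0 + \<sigma> * (\<Sum>k<n. c k) + (\<Sum>k<n. g k)"
      by (simp add: sum.distrib sum_distrib_left)
    also have "(\<Sum>k<n. g k) \<le> suminf g"
      by (rule sum_le_suminf) (use \<open>summable g\<close> g_nonneg in auto)
    finally show ?thesis using \<open>\<sigma> < 1\<close> by (simp add: field_simps)
  qed
  then have "summable c"
    by (intro summableI_nonneg_bounded c_nonneg)
  then show ?thesis by (simp add: c_def[abs_def] summable_iff_shift)
qed

text \<open>Polynomial weights cannot destroy a geometric contraction: the ratio \<open>R j\<close>
  of consecutive weights tends to 1, so \<open>\<sigma> * R j\<close> is eventually below the
  midpoint of \<open>\<sigma>\<close> and 1. The weighted noise has order
  \<open>j powr (s - r)\<close>, which is summable because \<open>s - r < -1\<close>.\<close>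

lemma summable_weighted_of_contraction:
  fixes a :: "nat \<Rightarrow> real"
  assumes nonneg: "\<And>j. 0 \<le> a j" and "0 \<le> \<sigma>" "\<sigma> < 1" "0 \<le> D" and rs: "1 < r - s"
    and step: "\<And>j. a (Suc j) \<le> \<sigma> * a j + D * real (Suc j) powr (- r)"
  shows "summable (\<lambda>j. real (Suc j) powr s * a j)"
proof -
  define R where "R j = (real (Suc (Suc j)) / real (Suc j)) powr s" for j
  have "(\<lambda>j. real (Suc (Suc j)) / real (Suc j)) \<longlonglongrightarrow> 1"
    using LIMSEQ_Suc[OF LIMSEQ_Suc_n_over_n[where ?'a = real]] by simp
  then have "R \<longlonglongrightarrow> 1 powr s"
    unfolding R_def by (intro tendsto_powr tendsto_const) auto
  then have R_lim: "R \<longlonglongrightarrow> 1" by simp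
  then have R_lim': "(\<lambda>j. \<sigma> * R j) \<longlonglongrightarrow> \<sigma> * 1"
    by (rule tendsto_mult_left)
  have "eventually (\<lambda>j. R j < 2 \<and> \<sigma> * R j < (1 + \<sigma>) / 2) sequentially"
    by (intro eventually_conj order_tendstoD(2)[OF R_lim] order_tendstoD(2)[OF R_lim'])
      (use \<open>\<sigma> < 1\<close> in auto)
  then obtain N where N: "\<And>j. N \<le> j \<Longrightarrow> R j \<le> 2" "\<And>j. N \<le> j \<Longrightarrow> \<sigma> * R j \<le> (1 + \<sigma>) / 2"
    unfolding eventually_sequentially by (metis less_imp_le)
  show ?thesis
  proof (rule summable_of_contraction[where \<sigma> = "(1 + \<sigma>) / 2" and N = N
        and f = "\<lambda>j. 2 * D * real (Suc j) powr (s - r)"])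
    have "summable (\<lambda>j. real j powr (s - r))"
      using rs by (simp add: summable_real_powr_iff)
    then show "summable (\<lambda>j. 2 * D * real (Suc j) powr (s - r))"
      by (intro summable_mult) (subst summable_Suc_iff)
  next
    fix j assume j: "N \<le> j"
    let ?w = "\<lambda>j. real (Suc j) powr s"
    have w: "?w (Suc j) = R j * ?w j"
      by (simp add: R_def powr_divide)
    have "?w (Suc j) * a (Suc j) \<le> ?w (Suc j) * (\<sigma> * a j + D * real (Suc j) powr (- r))"
      by (intro mult_left_mono step) simp
    also have "\<dots> = (\<sigma> * R j) * (?w j * a j) + R j * (D * real (Suc j) powr (s - r))"
      unfolding w by (simp add: powr_diff powr_minus field_simps)
    also have "\<dots> \<le> (1 + \<sigma>) / 2 * (?w j * a j) + 2 * (D * real (Suc j) powr (s - r))"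
      using N[OF j] nonneg \<open>0 \<le> D\<close> by (intro add_mono mult_right_mono) auto
    finally show "?w (Suc j) * a (Suc j)
        \<le> (1 + \<sigma>) / 2 * (?w j * a j) + 2 * D * real (Suc j) powr (s - r)" by simp
  qed (use assms in auto)
qed

text \<open>Convexity of the power, with \<open>a + e\<close> written as the convex combination of
  \<open>a / \<sigma>\<close> and \<open>e / (1 - \<sigma>)\<close>. It separates the contracting
  part from the noise without mixed terms.\<close>

lemma power_sum_le:
  fixes a e \<sigma> :: real
  assumes "0 \<le> a" "0 \<le> e" "0 < \<sigma>" "\<sigma> < 1"
  shows "(a + e) ^ p \<le> \<sigma> * (a / \<sigma>) ^ p + (1 - \<sigma>) * (e / (1 - \<sigma>)) ^ p"
proof -
  have "convex_on {0..} (\<lambda>x::real. x ^ p)"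
    by (cases "even p") (auto intro: convex_power_odd convex_on_subset[OF convex_power_even])
  moreover have "(a + e) ^ p = ((1 - \<sigma>) *\<^sub>R (e / (1 - \<sigma>)) + \<sigma> *\<^sub>R (a / \<sigma>)) ^ p"
    using assms by (simp add: add.commute)
  ultimately show ?thesis
    using assms convex_onD[of "{0..}" "\<lambda>x. x ^ p" \<sigma> "e / (1 - \<sigma>)" "a / \<sigma>"] by simp
qed

lemma integrable_mult_bounded:
  fixes f g :: "'a \<Rightarrow> real"
  assumes "integrable M f" "g \<in> borel_measurable M" "\<And>\<omega>. \<bar>g \<omega>\<bar> \<le> 1"
  shows "integrable M (\<lambda>\<omega>. g \<omega> * f \<omega>)"
  using assms
  by (intro Bochner_Integration.integrable_bound[OF assms(1)])
    (auto simp: abs_mult intro!: AE_I2 mult_left_le_one_le)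

text \<open>The sum of the powers \<open>(w j * y j) ^ p\<close> has finite expectation, since sum
  and integral of nonnegative functions commute. So it is finite almost surely, its terms tend to 0,
  and \<open>p\<close>-th roots preserve this.\<close>

lemma AE_tendsto_0_of_summable_moments:
  fixes y :: "nat \<Rightarrow> 'a \<Rightarrow> real"
  assumes int: "\<And>j. integrable M (\<lambda>\<omega>. y j \<omega> ^ p)" and nonneg: "\<And>j \<omega>. 0 \<le> y j \<omega>"
    and "0 < p" and w: "\<And>j. 0 \<le> w j"
    and sum: "summable (\<lambda>j. w j ^ p * (\<integral>\<omega>. y j \<omega> ^ p \<partial>M))"
  shows "AE \<omega> in M. (\<lambda>j. w j * y j \<omega>) \<longlonglongrightarrow> 0"
proof -
  have "(\<integral>\<^sup>+\<omega>. (\<Sum>j. ennreal ((w j * y j \<omega>) ^ p)) \<partial>M) = (\<Sum>j. \<integral>\<^sup>+\<omega>. ennreal ((w j * y j \<omega>) ^ p) \<partial>M)"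
    using borel_measurable_integrable[OF int]
    by (intro nn_integral_suminf) (auto simp: power_mult_distrib)
  also have "\<dots> = (\<Sum>j. ennreal (w j ^ p * (\<integral>\<omega>. y j \<omega> ^ p \<partial>M)))"
    using int nonneg w by (subst nn_integral_eq_integral) (auto simp: power_mult_distrib)
  also have "\<dots> \<noteq> \<top>"
    using sum nonneg w by (intro ennreal_suminf_neq_top) auto
  finally have "AE \<omega> in M. (\<Sum>j. ennreal ((w j * y j \<omega>) ^ p)) \<noteq> \<infinity>"
    using borel_measurable_integrable[OF int]
    by (intro nn_integral_noteq_infinite) (auto simp: power_mult_distrib intro!: borel_measurable_suminf_order)
  then show ?thesis
  proof eventually_elim
    case (elim \<omega>)
    then have "summable (\<lambda>j. (w j * y j \<omega>) ^ p)"
      using nonneg w by (intro summable_suminf_not_top) auto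
    then have "(\<lambda>j. (w j * y j \<omega>) ^ p) \<longlonglongrightarrow> 0" by (rule summable_LIMSEQ_zero)
    then have "(\<lambda>j. root p ((w j * y j \<omega>) ^ p)) \<longlonglongrightarrow> root p 0"
      by (rule tendsto_real_root)
    then show ?case
      using nonneg w \<open>0 < p\<close> by (simp add: real_root_power_cancel)
  qed
qed

text \<open>The hypothesis \<open>contraction\<close> expresses that the conditional expectation of
  \<open>lam j\<close> given \<open>G j\<close> is at most \<open>\<rho>\<close>, tested against
  bounded nonnegative functions. It is applied to the test function \<open>y j ^ p\<close>.\<close>

lemma (in prob_space) contracting_recursion_tendsto_0:
  fixes G :: "nat \<Rightarrow> 'a measure" and lam y :: "nat \<Rightarrow> 'a \<Rightarrow> real"
  assumes G: "filtration (space M) G" and sub: "\<And>j. subalgebra M (G j)"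
    and lam[measurable]: "\<And>j. lam j \<in> borel_measurable (G (Suc j))"
    and lam_bounds: "\<And>j \<omega>. 0 \<le> lam j \<omega>" "\<And>j \<omega>. lam j \<omega> \<le> 1"
    and contraction: "\<And>j Y c. Y \<in> borel_measurable (G j) \<Longrightarrow> (\<And>\<omega>. 0 \<le> Y \<omega>) \<Longrightarrow> (\<And>\<omega>. Y \<omega> \<le> c) \<Longrightarrow>
      (\<integral>\<omega>. lam j \<omega> * Y \<omega> \<partial>M) \<le> \<rho> * (\<integral>\<omega>. Y \<omega> \<partial>M)"
    and rho: "0 < \<rho>" "\<rho> < 1" and "0 \<le> C" and beta: "\<beta> < \<beta>'" "0 \<le> \<beta>'"
    and y_0: "\<And>\<omega>. y 0 \<omega> = 1"
    and y_Suc: "\<And>j \<omega>. y (Suc j) \<omega> = lam j \<omega> * y j \<omega> + C * real (Suc j) powr (- \<beta>')"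
  shows "AE \<omega> in M. (\<lambda>j. real (Suc j) powr \<beta> * y j \<omega>) \<longlonglongrightarrow> 0"
proof -
  interpret G: filtration "space M" G by fact
  have G_mono: "f \<in> borel_measurable (G i) \<Longrightarrow> i \<le> j \<Longrightarrow> f \<in> borel_measurable (G j)"
    for f :: "'a \<Rightarrow> real" and i j
    by (rule measurable_from_subalg[of "G j" "G i"])
      (auto simp: subalgebra_def G.space_F intro: G.sets_F_mono[THEN subsetD])
  define e where "e j = C * real (Suc j) powr (- \<beta>')" for j
  have e_nonneg: "0 \<le> e j" for j using \<open>0 \<le> C\<close> by (simp add: e_def)
  have e_le: "e j \<le> C" for j
  proof -
    have "real (Suc j) powr (- \<beta>') \<le> real (Suc j) powr 0"
      using beta by (intro powr_mono) auto
    then show ?thesis using \<open>0 \<le> C\<close> by (simp add: e_def mult_left_le)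
  qed
  have y_meas: "y j \<in> borel_measurable (G j)" for j
  proof (induction j)
    case 0
    have "y 0 = (\<lambda>_. 1)" using y_0 by auto
    then show ?case by simp
  next
    case (Suc j)
    have [measurable]: "y j \<in> borel_measurable (G (Suc j))"
      using G_mono[OF Suc] by simp
    have "y (Suc j) = (\<lambda>\<omega>. lam j \<omega> * y j \<omega> + C * real (Suc j) powr (- \<beta>'))"
      using y_Suc by auto
    then show ?case by simp
  qed
  have y_nonneg: "0 \<le> y j \<omega>" for j \<omega>
    by (induction j) (auto simp: y_0 y_Suc lam_bounds \<open>0 \<le> C\<close>)
  \<comment> \<open>This crude bound serves only to make the powers of \<open>y j\<close> integrable
    and admissible as test functions in \<open>contraction\<close>.\<close>
  have y_le: "y j \<omega> \<le> 1 + real j * C" for j \<omega>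
  proof (induction j)
    case (Suc j)
    have "lam j \<omega> * y j \<omega> \<le> y j \<omega>"
      using lam_bounds y_nonneg by (simp add: mult_left_le_one_le)
    then show ?case
      using Suc e_le[of j] by (simp add: y_Suc e_def algebra_simps)
  qed (simp add: y_0)
  obtain p0 where p0: "1 / (\<beta>' - \<beta>) < real p0" using reals_Archimedean2 by blast
  define p where "p = Suc p0"
  have p: "1 < real p * \<beta>' - real p * \<beta>" "0 < p"
    using p0 beta by (auto simp: p_def field_simps)
  \<comment> \<open>Convexity leaves the coefficient \<open>\<sigma> / \<rho>\<close> in front of
    \<open>lam j * y j ^ p\<close>. The expectation contributes a factor \<open>\<rho>\<close>, so
    the moments contract by \<open>\<sigma>\<close>, which is below 1.\<close>
  define \<sigma> where "\<sigma> = root p \<rho>"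
  have sigma: "0 < \<sigma>" "\<sigma> < 1" "\<sigma> ^ p = \<rho>"
    using rho p(2) by (auto simp: \<sigma>_def)
  have M_meas: "f \<in> borel_measurable (G j) \<Longrightarrow> f \<in> borel_measurable M" for f :: "'a \<Rightarrow> real" and j
    by (rule measurable_from_subalg[OF sub])
  have yp_le: "y j \<omega> ^ p \<le> (1 + real j * C) ^ p" for j \<omega>
    by (intro power_mono y_le y_nonneg)
  have yp_int: "integrable M (\<lambda>\<omega>. y j \<omega> ^ p)" for j
    using M_meas[OF y_meas] yp_le y_nonneg
    by (intro integrable_const_bound[where B = "(1 + real j * C) ^ p"]) auto
  have lam_yp_int: "integrable M (\<lambda>\<omega>. lam j \<omega> * y j \<omega> ^ p)" for j
    using lam_bounds by (intro integrable_mult_bounded yp_int M_meas[OF lam]) auto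
  define D where "D = (1 - \<sigma>) * (C / (1 - \<sigma>)) ^ p"
  have moment_step: "(\<integral>\<omega>. y (Suc j) \<omega> ^ p \<partial>M)
      \<le> \<sigma> * (\<integral>\<omega>. y j \<omega> ^ p \<partial>M) + D * real (Suc j) powr (- (real p * \<beta>'))" for j
  proof -
    have pw: "(real (Suc j) powr (- \<beta>')) ^ p = real (Suc j) powr (- (real p * \<beta>'))"
      by (subst powr_realpow[symmetric]) (simp_all add: powr_powr mult.commute)
    have noise: "(1 - \<sigma>) * (e j / (1 - \<sigma>)) ^ p = D * real (Suc j) powr (- (real p * \<beta>'))"
      by (simp add: D_def e_def power_mult_distrib power_divide pw del: of_nat_Suc)
    have bound: "y (Suc j) \<omega> ^ p \<le> \<sigma> / \<rho> * (lam j \<omega> * y j \<omega> ^ p) + D * real (Suc j) powr (- (real p * \<beta>'))" for \<omega>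
    proof -
      have "y (Suc j) \<omega> ^ p \<le> \<sigma> * (lam j \<omega> * y j \<omega> / \<sigma>) ^ p + (1 - \<sigma>) * (e j / (1 - \<sigma>)) ^ p"
        unfolding y_Suc e_def[symmetric]
        by (intro power_sum_le mult_nonneg_nonneg lam_bounds y_nonneg e_nonneg sigma)
      also have "\<sigma> * (lam j \<omega> * y j \<omega> / \<sigma>) ^ p = \<sigma> / \<rho> * (lam j \<omega> ^ p * y j \<omega> ^ p)"
        by (simp add: power_divide power_mult_distrib sigma(3))
      \<comment> \<open>Contraction in expectation is known only for the first power of
        \<open>lam j\<close>; as its values lie between 0 and 1, the higher power is dominated by
        it.\<close>
      also have "\<dots> \<le> \<sigma> / \<rho> * (lam j \<omega> * y j \<omega> ^ p)"
        using power_decreasing[of 1 p "lam j \<omega>"] p(2) lam_bounds y_nonneg sigma rho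
        by (intro mult_left_mono mult_right_mono) auto
      finally show ?thesis by (simp add: noise)
    qed
    have "(\<integral>\<omega>. y (Suc j) \<omega> ^ p \<partial>M)
        \<le> (\<integral>\<omega>. \<sigma> / \<rho> * (lam j \<omega> * y j \<omega> ^ p) + D * real (Suc j) powr (- (real p * \<beta>')) \<partial>M)"
      by (intro integral_mono yp_int bound Bochner_Integration.integrable_add integrable_mult_right lam_yp_int) auto
    also have "\<dots> = \<sigma> / \<rho> * (\<integral>\<omega>. lam j \<omega> * y j \<omega> ^ p \<partial>M) + D * real (Suc j) powr (- (real p * \<beta>'))"
      using lam_yp_int by (subst Bochner_Integration.integral_add) (auto simp: prob_space)
    also have "\<sigma> / \<rho> * (\<integral>\<omega>. lam j \<omega> * y j \<omega> ^ p \<partial>M) \<le> \<sigma> / \<rho> * (\<rho> * (\<integral>\<omega>. y j \<omega> ^ p \<partial>M))"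
      using y_meas[of j] y_nonneg sigma rho
      by (intro mult_left_mono contraction[OF _ _ yp_le]) auto
    finally show ?thesis using rho by simp
  qed
  have "summable (\<lambda>j. real (Suc j) powr (real p * \<beta>) * (\<integral>\<omega>. y j \<omega> ^ p \<partial>M))"
    by (rule summable_weighted_of_contraction[OF _ _ _ _ p(1) moment_step])
      (use sigma y_nonneg \<open>0 \<le> C\<close> in \<open>auto simp: D_def\<close>)
  moreover have "real (Suc j) powr (real p * \<beta>) = (real (Suc j) powr \<beta>) ^ p" for j
    by (subst powr_realpow[symmetric]) (simp_all add: powr_powr mult.commute)
  ultimately show ?thesis
    by (intro AE_tendsto_0_of_summable_moments[OF yp_int y_nonneg p(2)]) auto
qed

subsection \<open>Spreading in conditional expectation\<close>

text \<open>There are finitely many sets of pairs, and the preimage of each is given by finitely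
  many inequalities between entries. Every predicate of the random set then becomes measurable by
  composition.\<close>

lemma measurable_large_entries:
  fixes P :: "'a \<Rightarrow> real^'n^'n"
  assumes [measurable]: "\<And>i j. (\<lambda>\<omega>. P \<omega> $ i $ j) \<in> borel_measurable N"
  shows "(\<lambda>\<omega>. large_entries \<eta> (P \<omega>)) \<in> measurable N (count_space UNIV)"
proof (subst measurable_count_space_eq2, simp, intro conjI ballI)
  fix S :: "('n \<times> 'n) set"
  have "(\<lambda>\<omega>. large_entries \<eta> (P \<omega>)) -` {S} \<inter> space N
      = {\<omega> \<in> space N. \<forall>i c. (\<eta> \<le> P \<omega> $ i $ c) = ((i, c) \<in> S)}"
    by (auto simp: large_entries_def)
  also have "\<dots> \<in> sets N" by measurable
  finally show "(\<lambda>\<omega>. large_entries \<eta> (P \<omega>)) -` {S} \<inter> space N \<in> sets N" .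
qed auto

locale rooted_blocks = prob_space M + F: filtration "space M" F
  for M :: "'w measure" and F :: "nat \<Rightarrow> 'w measure" +
  fixes W :: "nat \<Rightarrow> 'w \<Rightarrow> real^'n^'n" and \<gamma> :: real and B t0 :: nat
  assumes subalg: "\<And>t. subalgebra M (F t)"
    and adapted: "\<And>t. W t \<in> borel_measurable (F t)"
    and stochastic: "\<And>t. t0 \<le> t \<Longrightarrow> AE \<omega> in M. row_stochastic (W t \<omega>)"
    and gamma: "0 < \<gamma>" "\<gamma> < 1"
    and self_loops: "\<And>t. t0 \<le> t \<Longrightarrow> AE \<omega> in M. \<forall>i. (i, i) \<in> edges \<gamma> (W t \<omega>)"
    and B_pos: "0 < B"
    and rooted: "\<And>t. t0 \<le> t \<Longrightarrow> AE \<omega> in M. has_spanning_rooted_tree (block_edges \<gamma> M F W B t \<omega>)"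
begin

section \<open>Measurability and almost sure regularity\<close>

lemma borel_measurable_F_mono:
  fixes f :: "'w \<Rightarrow> real"
  assumes "f \<in> borel_measurable (F s)" "s \<le> t"
  shows "f \<in> borel_measurable (F t)"
  by (rule measurable_from_subalg[OF _ assms(1)])
    (use assms(2) in \<open>auto simp: subalgebra_def F.space_F intro: F.sets_F_mono[THEN subsetD]\<close>)

lemma borel_measurable_M:
  fixes f :: "'w \<Rightarrow> real"
  assumes "f \<in> borel_measurable (F t)"
  shows "f \<in> borel_measurable M"
  by (rule measurable_from_subalg[OF subalg assms])

lemma W_entry_measurable:
  assumes "s \<le> t"
  shows "(\<lambda>\<omega>. W s \<omega> $ i $ j) \<in> borel_measurable (F t)"
proof (rule borel_measurable_F_mono[OF _ assms])
  have "(\<lambda>A :: real^'n^'n. A $ i $ j) \<in> borel_measurable borel"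
    by (intro borel_measurable_continuous_onI continuous_intros)
  then show "(\<lambda>\<omega>. W s \<omega> $ i $ j) \<in> borel_measurable (F s)"
    using measurable_compose[OF adapted] by blast
qed

lemma left_prod_measurable:
  "a + k \<le> t \<Longrightarrow> (\<lambda>\<omega>. left_prod (\<lambda>\<tau>. W \<tau> \<omega>) a k $ i $ j) \<in> borel_measurable (F t)"
proof (induction k arbitrary: i j)
  case 0
  then show ?case by simp
next
  case (Suc k)
  have [measurable]: "(\<lambda>\<omega>. left_prod (\<lambda>\<tau>. W \<tau> \<omega>) a k $ i $ j) \<in> borel_measurable (F t)" for i j
    using Suc by simp
  have [measurable]: "(\<lambda>\<omega>. W (Suc (a + k)) \<omega> $ i $ j) \<in> borel_measurable (F t)" for i j
    using Suc by (intro W_entry_measurable) simp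
  show ?case by (simp add: matrix_matrix_mult_def)
qed

text \<open>The almost sure assumptions at all times are merged into one event, on which the matrix
  estimates are deterministic.\<close>

definition regular :: "'w \<Rightarrow> bool" where
  "regular \<omega> \<longleftrightarrow> (\<forall>t\<ge>t0. row_stochastic (W t \<omega>) \<and> (\<forall>i. \<gamma> \<le> W t \<omega> $ i $ i))"

lemma AE_regular: "AE \<omega> in M. regular \<omega>"
  unfolding regular_def AE_all_countable
proof
  fix t
  show "AE \<omega> in M. t0 \<le> t \<longrightarrow> row_stochastic (W t \<omega>) \<and> (\<forall>i. \<gamma> \<le> W t \<omega> $ i $ i)"
  proof (cases "t0 \<le> t")
    case True
    then show ?thesis
      using stochastic[OF True] self_loops[OF True]
      by eventually_elim (auto simp: edges_def less_imp_le)
  qed simp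
qed

text \<open>An edge of the conditional graph gives
  \<open>\<gamma> ^ B * \<gamma> = 2 * \<epsilon>\<close> as a lower bound in conditional
  expectation. One half is the threshold for a large entry, the other half remains as a bound on the
  conditional probability.\<close>

definition \<epsilon> :: real where
  "\<epsilon> = \<gamma> ^ Suc B / 2"

lemma eps: "0 < \<epsilon>" "2 * \<epsilon> < 1" "\<epsilon> \<le> \<gamma> ^ B"
proof -
  have "\<gamma> ^ Suc B < 1" using gamma by (intro power_Suc_less_one) auto
  moreover have "\<gamma> ^ Suc B \<le> \<gamma> ^ B" using gamma by (simp add: mult_left_le_one_le)
  moreover have "0 < \<gamma> ^ Suc B" using gamma by simp
  ultimately show "0 < \<epsilon>" "2 * \<epsilon> < 1" "\<epsilon> \<le> \<gamma> ^ B" unfolding \<epsilon>_def by linarith+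
qed

text \<open>Covers the blocks \<open>s\<close> to \<open>s + k - 1\<close>, that is, the factors at
  times \<open>s * B + 1\<close> to \<open>(s + k) * B\<close>, matching the ranges in
  \<open>block_edges\<close>.\<close>

definition block_prod :: "nat \<Rightarrow> nat \<Rightarrow> 'w \<Rightarrow> real^'n^'n" where
  "block_prod s k \<omega> = left_prod (\<lambda>\<tau>. W \<tau> \<omega>) (s * B) (k * B)"

definition influence :: "nat \<Rightarrow> nat \<Rightarrow> 'w \<Rightarrow> ('n \<times> 'n) set" where
  "influence s k \<omega> = large_entries (\<epsilon> ^ k) (block_prod s k \<omega>)"

lemma block_prod_Suc: "block_prod s (Suc k) \<omega> = block_prod (s + k) 1 \<omega> ** block_prod s k \<omega>"
  using left_prod_add[of "\<lambda>\<tau>. W \<tau> \<omega>" "s * B" "k * B" B]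
  by (simp add: block_prod_def algebra_simps)

lemma influence_measurable:
  assumes "(s + k) * B \<le> t"
  shows "influence s k \<in> measurable (F t) (count_space UNIV)"
  unfolding influence_def[abs_def] block_prod_def using assms
  by (intro measurable_large_entries left_prod_measurable) (simp add: algebra_simps)

lemma block_regular:
  assumes "regular \<omega>" "t0 \<le> s" "s * B < t"
  shows "row_stochastic (W t \<omega>)" "\<gamma> \<le> W t \<omega> $ i $ i"
proof -
  have "s * 1 \<le> s * B" using B_pos by (intro mult_left_mono) auto
  then have "t0 \<le> t" using assms by linarith
  then show "row_stochastic (W t \<omega>)" "\<gamma> \<le> W t \<omega> $ i $ i"
    using assms(1) by (auto simp: regular_def)
qed

lemma row_stochastic_block_prod:
  assumes "regular \<omega>" "t0 \<le> s"
  shows "row_stochastic (block_prod s k \<omega>)"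
  unfolding block_prod_def by (intro row_stochastic_left_prod block_regular(1)[OF assms])

lemma block_prod_diag_ge:
  assumes "regular \<omega>" "t0 \<le> s"
  shows "\<epsilon> \<le> block_prod s 1 \<omega> $ i $ i"
  using left_prod_diag_ge[of "s * B" "\<lambda>\<tau>. W \<tau> \<omega>" \<gamma> B i] block_regular[OF assms] eps gamma
  by (simp add: block_prod_def)

lemma block_prod_entry_ge:
  assumes "regular \<omega>" "t0 \<le> s" "\<tau> \<in> {s * B + 1..(s + 1) * B}"
  shows "\<gamma> ^ B * W \<tau> \<omega> $ i $ j \<le> block_prod s 1 \<omega> $ i $ j"
  using left_prod_entry_ge[of "s * B" "\<lambda>\<tau>. W \<tau> \<omega>" \<gamma> \<tau> B i j] block_regular[OF assms(1,2)] gamma assms(3)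
  by (simp add: block_prod_def)

definition spread_ind :: "nat \<Rightarrow> nat \<Rightarrow> 'w \<Rightarrow> real" where
  "spread_ind s k \<omega> = of_bool (spread k (influence s k \<omega>))"

lemma spread_ind_le_1: "\<bar>spread_ind s k \<omega>\<bar> \<le> 1"
  by (simp add: spread_ind_def)

lemma spread_ind_measurable:
  assumes "(s + k) * B \<le> t"
  shows "spread_ind s k \<in> borel_measurable (F t)"
  unfolding spread_ind_def[abs_def]
  by (rule measurable_compose[OF influence_measurable[OF assms]]) simp

lemma integrable_bounded:
  fixes f :: "'w \<Rightarrow> real"
  assumes "f \<in> borel_measurable (F t)" "AE \<omega> in M. \<bar>f \<omega>\<bar> \<le> c"
  shows "integrable M f"
  using assms by (intro integrable_const_bound[where B = c] borel_measurable_M) auto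

lemma spread_ind_integrable: "integrable M (spread_ind s k)"
  by (rule integrable_bounded[OF spread_ind_measurable[OF order_refl], where c = 1])
    (simp add: spread_ind_def)

text \<open>Where an edge \<open>(a, b)\<close> from time \<open>\<tau>\<close> would add a large entry, pointwise
  \<open>spread_ind s (Suc k) \<ge> \<gamma> ^ B * W \<tau> $ b $ a - \<epsilon>\<close>; taking conditional expectations here
  avoids partitioning the space according to which edge is used.\<close>

lemma cond_exp_spread_ind_ge:
  assumes s: "t0 \<le> s"
  shows "AE \<omega> in M. \<epsilon> * spread_ind s k \<omega>
    \<le> real_cond_exp M (F ((s + k) * B)) (spread_ind s (Suc k)) \<omega>"
proof -
  let ?F = "F ((s + k) * B)"
  let ?E = "real_cond_exp M ?F"
  interpret S: finite_measure_subalgebra M ?F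
    by unfold_locales (rule subalg)
  let ?T = "{(s + k) * B + 1..(s + k + 1) * B}"
  have sk: "t0 \<le> s + k" using s by simp
  \<comment> \<open>This indicates that an edge \<open>(a, b)\<close> would add the entry
    \<open>(b, c)\<close>. It is known at the start of the block and can therefore be pulled out of
    the conditional expectation; \<open>h0\<close> treats the case of an already full
    column.\<close>
  define h where "h a b c \<omega> = (of_bool (spread k (influence s k \<omega>) \<and>
    (a, c) \<in> influence s k \<omega> \<and> (b, c) \<notin> influence s k \<omega>) :: real)" for a b c \<omega>
  define h0 where "h0 \<omega> = (of_bool (spread k (influence s k \<omega>) \<and>
    (\<exists>c. \<forall>i. (i, c) \<in> influence s k \<omega>)) :: real)" for \<omega>
  have h_meas: "h a b c \<in> borel_measurable ?F" for a b c
    unfolding h_def[abs_def] by (rule measurable_compose[OF influence_measurable[OF order_refl]]) simp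
  have h0_meas: "h0 \<in> borel_measurable ?F"
    unfolding h0_def[abs_def] by (rule measurable_compose[OF influence_measurable[OF order_refl]]) simp
  have h0_int: "integrable M h0"
    by (rule integrable_bounded[OF h0_meas, where c = 1]) (simp add: h0_def)
  have step: "influence s (Suc k) \<omega>
      = large_entries (\<epsilon> * \<epsilon> ^ k) (block_prod (s + k) 1 \<omega> ** block_prod s k \<omega>)" for \<omega>
    unfolding influence_def block_prod_Suc by simp
  have full: "AE \<omega> in M. h0 \<omega> \<le> spread_ind s (Suc k) \<omega>"
    using AE_regular
  proof eventually_elim
    case (elim \<omega>)
    show ?case
    proof (cases "h0 \<omega> = 0")
      case True
      then show ?thesis by (simp add: spread_ind_def)
    next
      case False
      then obtain c where "spread k (influence s k \<omega>)" "\<forall>i. (i, c) \<in> influence s k \<omega>"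
        by (auto simp: h0_def)
      then have "spread (Suc k) (influence s (Suc k) \<omega>)"
        unfolding step using eps elim s sk
        by (intro spread_mult_full_column[where c = c] row_stochastic_block_prod block_prod_diag_ge)
          (auto simp: influence_def)
      then show ?thesis by (simp add: h0_def spread_ind_def)
    qed
  qed
  have W_int: "integrable M (\<lambda>\<omega>. W \<tau> \<omega> $ b $ a)" if "\<tau> \<in> ?T" for \<tau> a b
  proof (rule integrable_bounded[OF W_entry_measurable[OF order_refl], where c = 1])
    show "AE \<omega> in M. \<bar>W \<tau> \<omega> $ b $ a\<bar> \<le> 1"
      using AE_regular
    proof eventually_elim
      case (elim \<omega>)
      then have "row_stochastic (W \<tau> \<omega>)"
        using block_regular(1)[OF elim sk, of \<tau>] that by simp
      then show ?case using row_stochastic_le_1 by (auto simp: row_stochastic_def)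
    qed
  qed
  have W_step_int: "integrable M (\<lambda>\<omega>. \<gamma> ^ B * W \<tau> \<omega> $ b $ a - \<epsilon>)" if "\<tau> \<in> ?T" for \<tau> a b
    using W_int[OF that] by simp
  have edge: "AE \<omega> in M. h a b c \<omega> * (\<gamma> ^ B * W \<tau> \<omega> $ b $ a - \<epsilon>) \<le> spread_ind s (Suc k) \<omega>"
    if tau: "\<tau> \<in> ?T" for a b c \<tau>
    using AE_regular
  proof eventually_elim
    case (elim \<omega>)
    have ge: "\<gamma> ^ B * W \<tau> \<omega> $ b $ a \<le> block_prod (s + k) 1 \<omega> $ b $ a"
      by (rule block_prod_entry_ge[OF elim sk tau])
    show ?case
    proof (cases "h a b c \<omega> = 0")
      case True
      then show ?thesis by (simp add: spread_ind_def)
    next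
      case False
      then have h: "h a b c \<omega> = 1" "spread k (influence s k \<omega>)"
        "(a, c) \<in> influence s k \<omega>" "(b, c) \<notin> influence s k \<omega>"
        by (auto simp: h_def)
      show ?thesis
      \<comment> \<open>If the block entry reaches \<open>\<epsilon>\<close>, the spread grows and
        the left side is at most 1 because block entries are. Otherwise the left side is
        negative.\<close>
      proof (cases "\<epsilon> \<le> block_prod (s + k) 1 \<omega> $ b $ a")
        case True
        then have "spread (Suc k) (influence s (Suc k) \<omega>)"
          unfolding step using eps elim s sk h
          by (intro spread_mult_edge[where a = a and b = b and c = c]
              row_stochastic_block_prod block_prod_diag_ge)
            (auto simp: influence_def)
        moreover have "block_prod (s + k) 1 \<omega> $ b $ a \<le> 1"
          by (rule row_stochastic_le_1[OF row_stochastic_block_prod[OF elim sk]])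
        ultimately show ?thesis using ge h eps by (simp add: spread_ind_def)
      next
        case False
        then show ?thesis using ge h by (simp add: spread_ind_def)
      qed
    qed
  qed
  have full_cond: "AE \<omega> in M. h0 \<omega> \<le> ?E (spread_ind s (Suc k)) \<omega>"
    using S.real_cond_exp_mono[OF full h0_int spread_ind_integrable]
      S.real_cond_exp_F_meas[OF h0_int h0_meas]
    by eventually_elim simp
  \<comment> \<open>There are finitely many choices of \<open>a\<close>, \<open>b\<close>,
    \<open>c\<close> and \<open>\<tau>\<close>, so one null set serves them all. This permits
    inserting below an edge that depends on \<open>\<omega>\<close>.\<close>
  have edge_cond: "AE \<omega> in M. \<forall>a b c. \<forall>\<tau>\<in>?T.
      h a b c \<omega> * (\<gamma> ^ B * ?E (\<lambda>\<omega>. W \<tau> \<omega> $ b $ a) \<omega> - \<epsilon>) \<le> ?E (spread_ind s (Suc k)) \<omega>"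
  proof (intro AE_all_countable[THEN iffD2] allI AE_ball_countable[THEN iffD2] ballI)
    fix a b c \<tau> assume tau: "\<tau> \<in> ?T"
    have int: "integrable M (\<lambda>\<omega>. h a b c \<omega> * (\<gamma> ^ B * W \<tau> \<omega> $ b $ a - \<epsilon>))"
      by (intro integrable_mult_bounded W_step_int[OF tau] borel_measurable_M[OF h_meas])
        (simp add: h_def)
    have "AE \<omega> in M. ?E (\<lambda>\<omega>. h a b c \<omega> * (\<gamma> ^ B * W \<tau> \<omega> $ b $ a - \<epsilon>)) \<omega>
        \<le> ?E (spread_ind s (Suc k)) \<omega>"
      by (rule S.real_cond_exp_mono[OF edge[OF tau] int spread_ind_integrable])
    moreover have "AE \<omega> in M. ?E (\<lambda>\<omega>. h a b c \<omega> * (\<gamma> ^ B * W \<tau> \<omega> $ b $ a - \<epsilon>)) \<omega>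
        = h a b c \<omega> * ?E (\<lambda>\<omega>. \<gamma> ^ B * W \<tau> \<omega> $ b $ a - \<epsilon>) \<omega>"
      by (rule S.real_cond_exp_mult[OF h_meas borel_measurable_integrable[OF W_step_int[OF tau]] int])
    moreover have "AE \<omega> in M. ?E (\<lambda>\<omega>. \<gamma> ^ B * W \<tau> \<omega> $ b $ a - \<epsilon>) \<omega>
        = ?E (\<lambda>\<omega>. \<gamma> ^ B * W \<tau> \<omega> $ b $ a) \<omega> - ?E (\<lambda>\<omega>. \<epsilon>) \<omega>"
      using W_int[OF tau] by (intro S.real_cond_exp_diff) auto
    moreover have "AE \<omega> in M. ?E (\<lambda>\<omega>. \<epsilon>) \<omega> = \<epsilon>"
      by (intro S.real_cond_exp_F_meas) auto
    moreover have "AE \<omega> in M. ?E (\<lambda>\<omega>. \<gamma> ^ B * W \<tau> \<omega> $ b $ a) \<omega> = \<gamma> ^ B * ?E (\<lambda>\<omega>. W \<tau> \<omega> $ b $ a) \<omega>"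
      by (rule S.real_cond_exp_cmult[OF W_int[OF tau]])
    ultimately show "AE \<omega> in M. h a b c \<omega> * (\<gamma> ^ B * ?E (\<lambda>\<omega>. W \<tau> \<omega> $ b $ a) \<omega> - \<epsilon>)
        \<le> ?E (spread_ind s (Suc k)) \<omega>"
      by eventually_elim simp
  qed auto
  have nonneg: "AE \<omega> in M. 0 \<le> ?E (spread_ind s (Suc k)) \<omega>"
    by (intro S.real_cond_exp_pos borel_measurable_integrable spread_ind_integrable)
      (simp add: spread_ind_def)
  show ?thesis
    using full_cond edge_cond nonneg rooted[OF sk]
  proof eventually_elim
    case (elim \<omega>)
    show ?case
    proof (cases "spread k (influence s k \<omega>)")
      case False
      then show ?thesis using elim(3) by (simp add: spread_ind_def)
    next
      case spr: True
      show ?thesis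
      proof (cases "\<exists>c. \<forall>i. (i, c) \<in> influence s k \<omega>")
        case True
        then show ?thesis using elim(1) spr eps by (simp add: h0_def spread_ind_def)
      next
        case False
        obtain a b c where abc: "(a, b) \<in> block_edges \<gamma> M F W B (s + k) \<omega>"
          "(a, c) \<in> influence s k \<omega>" "(b, c) \<notin> influence s k \<omega>"
          by (rule spread_obtains_edge[OF elim(4) spr False])
        then obtain \<tau> where tau: "\<tau> \<in> ?T" "\<gamma> < ?E (\<lambda>\<omega>. W \<tau> \<omega> $ b $ a) \<omega>"
          by (auto simp: block_edges_def edges_def mat_cond_exp_def)
        have "h a b c \<omega> = 1" using spr abc by (simp add: h_def)
        then have "\<gamma> ^ B * ?E (\<lambda>\<omega>. W \<tau> \<omega> $ b $ a) \<omega> - \<epsilon> \<le> ?E (spread_ind s (Suc k)) \<omega>"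
          using elim(2) tau(1) by (metis mult_1)
        moreover have "\<gamma> ^ B * \<gamma> \<le> \<gamma> ^ B * ?E (\<lambda>\<omega>. W \<tau> \<omega> $ b $ a) \<omega>"
          using tau(2) gamma by (intro mult_left_mono) auto
        ultimately show ?thesis using spr by (simp add: spread_ind_def \<epsilon>_def mult.commute)
      qed
    qed
  qed
qed

text \<open>A weak form of the claim that the conditional probability of spread given
  \<open>F (s * B)\<close> is at least \<open>\<epsilon> ^ k\<close>. Since \<open>Y\<close> is
  known at the start of each later block, the indicator may be replaced by its conditional
  expectation under the integral, and each block costs one factor \<open>\<epsilon>\<close>.\<close>

lemma integral_spread_ind_ge:
  assumes s: "t0 \<le> s" and Y: "Y \<in> borel_measurable (F (s * B))" "\<And>\<omega>. 0 \<le> Y \<omega>" "\<And>\<omega>. Y \<omega> \<le> c"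
  shows "\<epsilon> ^ k * (\<integral>\<omega>. Y \<omega> \<partial>M) \<le> (\<integral>\<omega>. Y \<omega> * spread_ind s k \<omega> \<partial>M)"
proof (induction k)
  case 0
  have "spread_ind s 0 \<omega> = 1" for \<omega>
    by (simp add: spread_ind_def influence_def block_prod_def spread_mat_1)
  then show ?case by simp
next
  case (Suc k)
  let ?F = "F ((s + k) * B)"
  let ?E = "real_cond_exp M ?F"
  interpret S: finite_measure_subalgebra M ?F
    by unfold_locales (rule subalg)
  have Y_meas: "Y \<in> borel_measurable ?F"
    by (rule borel_measurable_F_mono[OF Y(1)]) simp
  have Y_int: "integrable M Y"
    using Y by (intro integrable_bounded[OF Y(1), where c = c]) auto
  have Y_ind_int: "integrable M (\<lambda>\<omega>. Y \<omega> * spread_ind s k \<omega>)" for k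
    using integrable_mult_bounded[OF Y_int borel_measurable_integrable[OF spread_ind_integrable], of s k]
    by (simp add: spread_ind_le_1 mult.commute)
  have "\<epsilon> ^ Suc k * (\<integral>\<omega>. Y \<omega> \<partial>M) \<le> \<epsilon> * (\<integral>\<omega>. Y \<omega> * spread_ind s k \<omega> \<partial>M)"
    using Suc eps by simp
  also have "\<dots> = (\<integral>\<omega>. Y \<omega> * (\<epsilon> * spread_ind s k \<omega>) \<partial>M)"
    by (subst integral_mult_right_zero[symmetric]) (simp add: mult_ac)
  also have "\<dots> \<le> (\<integral>\<omega>. Y \<omega> * ?E (spread_ind s (Suc k)) \<omega> \<partial>M)"
  proof (rule integral_mono_AE)
    show "integrable M (\<lambda>\<omega>. Y \<omega> * (\<epsilon> * spread_ind s k \<omega>))"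
      using integrable_mult_right[OF Y_ind_int[of k], of \<epsilon>] by (simp add: mult_ac)
    show "integrable M (\<lambda>\<omega>. Y \<omega> * ?E (spread_ind s (Suc k)) \<omega>)"
      by (rule S.real_cond_exp_intg(1)[OF Y_ind_int Y_meas])
        (rule borel_measurable_integrable[OF spread_ind_integrable])
    show "AE \<omega> in M. Y \<omega> * (\<epsilon> * spread_ind s k \<omega>) \<le> Y \<omega> * ?E (spread_ind s (Suc k)) \<omega>"
      using cond_exp_spread_ind_ge[OF s, of k] by eventually_elim (simp add: Y(2) mult_left_mono)
  qed
  also have "\<dots> = (\<integral>\<omega>. Y \<omega> * spread_ind s (Suc k) \<omega> \<partial>M)"
    by (rule S.real_cond_exp_intg(2)[OF Y_ind_int Y_meas])
      (rule borel_measurable_integrable[OF spread_ind_integrable])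
  finally show ?case .
qed

section \<open>Contraction over a superblock of \<open>K\<close> blocks\<close>

definition K :: nat where
  "K = CARD('n) * CARD('n)"

text \<open>After \<open>K\<close> blocks, spread means a full column with entries at least
  \<open>\<epsilon> ^ K\<close>, which reduces the diameter by that proportion. Without spread only
  the trivial factor 1 remains.\<close>

definition contraction_factor :: "nat \<Rightarrow> 'w \<Rightarrow> real" where
  "contraction_factor s \<omega> = 1 - \<epsilon> ^ K * spread_ind s K \<omega>"

text \<open>One factor \<open>\<epsilon> ^ K\<close> is the gain when spread occurs, the other the
  lower bound for its conditional probability.\<close>

definition \<rho> :: real where
  "\<rho> = 1 - \<epsilon> ^ K * \<epsilon> ^ K"

lemma eps_power: "0 < \<epsilon> ^ K" "\<epsilon> ^ K \<le> 1" "\<epsilon> ^ K < 1"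
proof -
  have "0 < K" by (simp add: K_def)
  then show "\<epsilon> ^ K < 1" using eps by (simp add: power_less_one_iff)
  then show "0 < \<epsilon> ^ K" "\<epsilon> ^ K \<le> 1" using eps by auto
qed

lemma rho: "0 < \<rho>" "\<rho> < 1"
  using eps_power mult_strict_mono[of "\<epsilon> ^ K" 1 "\<epsilon> ^ K" 1] by (auto simp: \<rho>_def)

lemma contraction_factor_bounds: "0 \<le> contraction_factor s \<omega>" "contraction_factor s \<omega> \<le> 1"
  using eps_power by (auto simp: contraction_factor_def spread_ind_def)

lemma contraction_factor_measurable:
  "contraction_factor s \<in> borel_measurable (F ((s + K) * B))"
  unfolding contraction_factor_def[abs_def]
  by (intro borel_measurable_diff borel_measurable_times borel_measurable_const
      spread_ind_measurable order_refl)

lemma integral_contraction_factor_le: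
  assumes s: "t0 \<le> s" and Y: "Y \<in> borel_measurable (F (s * B))" "\<And>\<omega>. 0 \<le> Y \<omega>" "\<And>\<omega>. Y \<omega> \<le> c"
  shows "(\<integral>\<omega>. contraction_factor s \<omega> * Y \<omega> \<partial>M) \<le> \<rho> * (\<integral>\<omega>. Y \<omega> \<partial>M)"
proof -
  have Y_int: "integrable M Y"
    using Y by (intro integrable_bounded[OF Y(1), where c = c]) auto
  have Y_ind_int: "integrable M (\<lambda>\<omega>. Y \<omega> * spread_ind s K \<omega>)"
    using integrable_mult_bounded[OF Y_int borel_measurable_integrable[OF spread_ind_integrable], of s K]
    by (simp add: spread_ind_le_1 mult.commute)
  have "(\<integral>\<omega>. contraction_factor s \<omega> * Y \<omega> \<partial>M) = (\<integral>\<omega>. Y \<omega> - \<epsilon> ^ K * (Y \<omega> * spread_ind s K \<omega>) \<partial>M)"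
    by (simp add: contraction_factor_def algebra_simps)
  also have "\<dots> = (\<integral>\<omega>. Y \<omega> \<partial>M) - \<epsilon> ^ K * (\<integral>\<omega>. Y \<omega> * spread_ind s K \<omega> \<partial>M)"
    using Y_int Y_ind_int by (subst Bochner_Integration.integral_diff) auto
  also have "\<dots> \<le> \<rho> * (\<integral>\<omega>. Y \<omega> \<partial>M)"
    using mult_left_mono[OF integral_spread_ind_ge[OF s Y, of K], of "\<epsilon> ^ K"] eps_power
    by (simp add: \<rho>_def algebra_simps)
  finally show ?thesis .
qed

lemma diam_block_prod_le:
  fixes z :: "real^'m^'n"
  assumes "regular \<omega>" "t0 \<le> s"
  shows "diam (block_prod s K \<omega> ** z) \<le> contraction_factor s \<omega> * diam z"
proof (cases "spread K (influence s K \<omega>)")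
  case True
  then obtain c where "\<forall>i. (i, c) \<in> influence s K \<omega>"
    using spread_full_column unfolding K_def by blast
  then have "diam (block_prod s K \<omega> ** z) \<le> (1 - \<epsilon> ^ K) * diam z"
    using eps_power by (intro diam_matrix_mult_le[where c = c] row_stochastic_block_prod assms)
      (auto simp: influence_def large_entries_def)
  then show ?thesis using True by (simp add: contraction_factor_def spread_ind_def)
next
  case False
  then show ?thesis
    using diam_row_stochastic_mult_le[OF row_stochastic_block_prod[OF assms]]
    by (simp add: contraction_factor_def spread_ind_def)
qed

end

section \<open>From superblocks to all times\<close>

lemma tendsto_0_of_block_bounds:
  fixes d b :: "nat \<Rightarrow> real"
  assumes "0 < L" and nonneg: "\<And>t. 0 \<le> d t" and b_nonneg: "\<And>j. 0 \<le> b j"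
    and bound: "\<And>j k. k < L \<Longrightarrow> d ((c + j) * L + k) \<le> b j"
    and lim: "(\<lambda>j. real (Suc j) powr \<beta> * b j) \<longlonglongrightarrow> 0" and "0 \<le> \<beta>"
  shows "(\<lambda>t. d t * real t powr \<beta>) \<longlonglongrightarrow> 0"
proof (rule tendsto_sandwich[OF _ _ tendsto_const])
  \<comment> \<open>For \<open>t\<close> at least \<open>c * L\<close>, the time \<open>t\<close>
    lies in superblock \<open>c + j t\<close> and is at most \<open>(c + 1) * L * Suc (j t)\<close>.
    Hence \<open>real t powr \<beta>\<close> exceeds \<open>real (Suc (j t)) powr \<beta>\<close> by
    at most the factor \<open>D\<close>.\<close>
  define j where "j t = t div L - c" for t
  define D where "D = real ((c + 1) * L) powr \<beta>"
  show "eventually (\<lambda>t. 0 \<le> d t * real t powr \<beta>) sequentially"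
    by (simp add: nonneg)
  show "eventually (\<lambda>t. d t * real t powr \<beta> \<le> D * (real (Suc (j t)) powr \<beta> * b (j t))) sequentially"
    using eventually_ge_at_top[of "c * L"]
  proof eventually_elim
    case (elim t)
    then have "c \<le> t div L" using \<open>0 < L\<close> by (simp add: less_eq_div_iff_mult_less_eq)
    then have t: "t = (c + j t) * L + t mod L" by (simp add: j_def)
    have mod: "t mod L < L" using \<open>0 < L\<close> by simp
    have "t < (c + j t + 1) * L"
      using mod by (subst t) simp
    also have "\<dots> \<le> (c + 1) * L * Suc (j t)" by (simp add: algebra_simps)
    finally have "real t \<le> real ((c + 1) * L * Suc (j t))" by (intro of_nat_mono) simp
    then have "real t powr \<beta> \<le> real ((c + 1) * L * Suc (j t)) powr \<beta>"
      using \<open>0 \<le> \<beta>\<close> by (intro powr_mono2) auto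
    also have "\<dots> = D * real (Suc (j t)) powr \<beta>"
      unfolding D_def of_nat_mult by (simp add: powr_mult)
    finally have "d t * real t powr \<beta> \<le> b (j t) * (D * real (Suc (j t)) powr \<beta>)"
      using bound[OF mod, of "j t"] t b_nonneg by (intro mult_mono) (auto simp: nonneg)
    then show ?case by (simp add: mult_ac)
  qed
  have "filterlim j at_top sequentially"
    unfolding filterlim_at_top
  proof
    fix Z
    show "eventually (\<lambda>t. Z \<le> j t) sequentially"
      using eventually_ge_at_top[of "(c + Z) * L"]
    proof eventually_elim
      case (elim t)
      then have "c + Z \<le> t div L"
        using \<open>0 < L\<close> by (simp add: less_eq_div_iff_mult_less_eq)
      then show ?case by (simp add: j_def)
    qed
  qed
  from tendsto_mult_right_zero[OF filterlim_compose[OF lim this]]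
  show "(\<lambda>t. D * (real (Suc (j t)) powr \<beta> * b (j t))) \<longlonglongrightarrow> 0" .
qed

text \<open>The perturbation \<open>u\<close> need not be adapted, so the diameters are compared
  with the adapted recursion \<open>y\<close>, which only uses the deterministic bound on \<open>u\<close>; the constant
  factor between the two may be random.\<close>

lemma (in rooted_blocks) perturbed_consensus:
  fixes x u :: "nat \<Rightarrow> 'w \<Rightarrow> real^'m^'n"
  assumes x_step: "\<And>t \<omega>. t0 \<le> t \<Longrightarrow> \<omega> \<in> space M \<Longrightarrow> x (Suc t) \<omega> = W (Suc t) \<omega> ** x t \<omega> + u t \<omega>"
    and beta: "0 \<le> \<beta>" "\<beta> < \<beta>'" and "0 \<le> q"
    and u_bound: "\<And>t. t0 \<le> t \<Longrightarrow> 0 < t \<Longrightarrow> AE \<omega> in M. diam (u t \<omega>) < q * real t powr (- \<beta>')"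
  shows "AE \<omega> in M. (\<lambda>t. diam (x t \<omega>) * real t powr \<beta>) \<longlonglongrightarrow> 0"
proof -
  \<comment> \<open>The successor makes all times from \<open>c * L\<close> on positive, as the
    bound on \<open>u\<close> demands; they are also at least \<open>t0\<close> because
    \<open>L\<close> is positive.\<close>
  define c where "c = Suc t0"
  define L where "L = K * B"
  define C where "C = real L * q"
  define s where "s j = (c + j) * K" for j
  have K_pos: "0 < K" by (simp add: K_def)
  have L_pos: "0 < L" using K_pos B_pos by (simp add: L_def)
  have C_nonneg: "0 \<le> C" using \<open>0 \<le> q\<close> by (simp add: C_def)
  have s_ge: "t0 \<le> s j" for j
  proof -
    have "(c + j) * 1 \<le> (c + j) * K" using K_pos by (intro mult_left_mono) auto
    then show ?thesis by (simp add: s_def c_def)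
  qed
  have s_B: "s j * B = (c + j) * L" for j by (simp add: s_def L_def)
  have s_Suc: "s (Suc j) = s j + K" for j by (simp add: s_def)
  define e where "e j = C * real (Suc j) powr (- \<beta>')" for j
  define y where "y = rec_nat (\<lambda>_. 1) (\<lambda>j yj \<omega>. contraction_factor (s j) \<omega> * yj \<omega> + e j)"
  have y_0: "y 0 \<omega> = 1" for \<omega> by (simp add: y_def)
  have y_Suc: "y (Suc j) \<omega> = contraction_factor (s j) \<omega> * y j \<omega> + e j" for j \<omega>
    by (simp add: y_def)
  have e_nonneg: "0 \<le> e j" for j using C_nonneg by (simp add: e_def)
  have y_nonneg: "0 \<le> y j \<omega>" for j \<omega>
    by (induction j) (auto simp: y_0 y_Suc contraction_factor_bounds e_nonneg)
  have y_lim: "AE \<omega> in M. (\<lambda>j. real (Suc j) powr \<beta> * y j \<omega>) \<longlonglongrightarrow> 0"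
  proof (rule contracting_recursion_tendsto_0[where G = "\<lambda>j. F (s j * B)"
        and lam = "\<lambda>j. contraction_factor (s j)" and \<rho> = \<rho> and C = C and \<beta>' = \<beta>'])
    show "filtration (space M) (\<lambda>j. F (s j * B))"
    proof
      fix i j :: nat assume "i \<le> j"
      then show "sets (F (s i * B)) \<subseteq> sets (F (s j * B))"
        by (intro F.sets_F_mono) (simp add: s_def)
    qed (simp add: F.space_F)
    show "contraction_factor (s j) \<in> borel_measurable (F (s (Suc j) * B))" for j
      unfolding s_Suc by (rule contraction_factor_measurable)
    show "(\<integral>\<omega>. contraction_factor (s j) \<omega> * Y \<omega> \<partial>M) \<le> \<rho> * (\<integral>\<omega>. Y \<omega> \<partial>M)"
      if "Y \<in> borel_measurable (F (s j * B))" "\<And>\<omega>. 0 \<le> Y \<omega>" "\<And>\<omega>. Y \<omega> \<le> b" for j Y b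
      by (rule integral_contraction_factor_le[OF s_ge that])
  qed (use beta C_nonneg rho in
      \<open>auto simp: y_0 y_Suc e_def contraction_factor_bounds intro: subalg\<close>)
  have "AE \<omega> in M. \<forall>t. c \<le> t \<longrightarrow> diam (u t \<omega>) \<le> q * real t powr (- \<beta>')"
    unfolding AE_all_countable
  proof
    fix t
    show "AE \<omega> in M. c \<le> t \<longrightarrow> diam (u t \<omega>) \<le> q * real t powr (- \<beta>')"
    proof (cases "c \<le> t")
      case True
      then have "AE \<omega> in M. diam (u t \<omega>) < q * real t powr (- \<beta>')"
        by (intro u_bound) (auto simp: c_def)
      then show ?thesis by eventually_elim simp
    qed simp
  qed
  then show ?thesis
    using AE_regular y_lim AE_space
  proof eventually_elim
    case (elim \<omega>)
    define d where "d t = diam (x t \<omega>)" for t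
    \<comment> \<open>Every time in the superblock is at least \<open>c + j\<close>, hence at least
      \<open>Suc j\<close>, and there are at most \<open>L\<close> perturbations; this explains
      \<open>C = real L * q\<close>.\<close>
    have noise: "(\<Sum>l<k. diam (u ((c + j) * L + l) \<omega>)) \<le> e j" if "k \<le> L" for j k
    proof -
      have "diam (u ((c + j) * L + l) \<omega>) \<le> q * real (Suc j) powr (- \<beta>')" for l
      proof -
        have "(c + j) * 1 \<le> (c + j) * L" using L_pos by (intro mult_left_mono) auto
        then have ge: "c + j \<le> (c + j) * L + l"
          by (metis nat_mult_1_right trans_le_add1)
        then have le: "real (Suc j) \<le> real ((c + j) * L + l)"
          by (intro of_nat_mono) (simp add: c_def)
        have "c \<le> (c + j) * L + l" using ge by linarith
        then have "diam (u ((c + j) * L + l) \<omega>) \<le> q * real ((c + j) * L + l) powr (- \<beta>')"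
          using elim(1) by blast
        also have "\<dots> \<le> q * real (Suc j) powr (- \<beta>')"
          using le beta \<open>0 \<le> q\<close> by (intro mult_left_mono powr_mono2') linarith+
        finally show ?thesis .
      qed
      then have "(\<Sum>l<k. diam (u ((c + j) * L + l) \<omega>)) \<le> real k * (q * real (Suc j) powr (- \<beta>'))"
        using sum_bounded_above[of "{..<k}"] by (metis card_lessThan)
      also have "\<dots> \<le> real L * (q * real (Suc j) powr (- \<beta>'))"
        using that \<open>0 \<le> q\<close> by (intro mult_right_mono) auto
      finally show ?thesis by (simp add: e_def C_def mult_ac)
    qed
    have in_block: "d ((c + j) * L + k)
        \<le> diam (left_prod (\<lambda>\<tau>. W \<tau> \<omega>) (s j * B) k ** x ((c + j) * L) \<omega>) + e j" if "k \<le> L" for j k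
    proof -
      have "t0 \<le> s j * B" using s_ge[of j] B_pos by (metis le_trans mult_le_mono2 nat_mult_1_right Suc_leI One_nat_def)
      then have "d ((c + j) * L + k)
          \<le> diam (left_prod (\<lambda>\<tau>. W \<tau> \<omega>) (s j * B) k ** x (s j * B) \<omega>)
            + (\<Sum>l<k. diam (u (s j * B + l) \<omega>))"
        unfolding d_def s_B[symmetric]
        by (intro diam_perturbed_le x_step elim(4)) (use block_regular(1)[OF elim(2) s_ge] in auto)
      then show ?thesis using noise[OF that, of j] by (simp add: s_B)
    qed
    have between: "d ((c + j) * L + k) \<le> d ((c + j) * L) + e j" if "k \<le> L" for j k
    proof -
      have "diam (left_prod (\<lambda>\<tau>. W \<tau> \<omega>) (s j * B) k ** x ((c + j) * L) \<omega>) \<le> d ((c + j) * L)"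
        unfolding d_def
        by (intro diam_row_stochastic_mult_le row_stochastic_left_prod block_regular(1)[OF elim(2) s_ge])
      then show ?thesis using in_block[OF that, of j] by simp
    qed
    have contract: "d ((c + Suc j) * L) \<le> contraction_factor (s j) \<omega> * d ((c + j) * L) + e j" for j
    proof -
      have "diam (left_prod (\<lambda>\<tau>. W \<tau> \<omega>) (s j * B) L ** x ((c + j) * L) \<omega>)
          \<le> contraction_factor (s j) \<omega> * d ((c + j) * L)"
        using diam_block_prod_le[OF elim(2) s_ge, of j] by (simp add: d_def block_prod_def L_def)
      then show ?thesis using in_block[OF order_refl, of j] by (simp add: algebra_simps)
    qed
    \<comment> \<open>The initial diameter starts the induction, since \<open>y 0\<close> is 1;
      being at least 1 lets \<open>R * e j\<close> absorb the noise \<open>e j\<close> in each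
      step.\<close>
    define R where "R = max 1 (d (c * L))"
    have major: "d ((c + j) * L) \<le> R * y j \<omega>" for j
    proof (induction j)
      case 0
      then show ?case by (simp add: y_0 R_def)
    next
      case (Suc j)
      have "d ((c + Suc j) * L) \<le> contraction_factor (s j) \<omega> * (R * y j \<omega>) + 1 * e j"
        using contract[of j] mult_left_mono[OF Suc contraction_factor_bounds(1), of "s j" \<omega>] by simp
      also have "\<dots> \<le> contraction_factor (s j) \<omega> * (R * y j \<omega>) + R * e j"
        by (intro add_left_mono mult_right_mono e_nonneg) (simp add: R_def)
      finally show ?case by (simp add: y_Suc algebra_simps)
    qed
    have e_lim: "(\<lambda>j. real (Suc j) powr \<beta> * e j) \<longlonglongrightarrow> 0"
    proof -
      have "(\<lambda>j. C * real (Suc j) powr (\<beta> - \<beta>')) \<longlonglongrightarrow> 0"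
        using beta by (intro tendsto_mult_right_zero LIMSEQ_Suc[of "\<lambda>j. real j powr (\<beta> - \<beta>')"]
            tendsto_neg_powr filterlim_real_sequentially) auto
      then show ?thesis by (simp add: e_def powr_diff powr_minus field_simps del: of_nat_Suc)
    qed
    have "(\<lambda>j. real (Suc j) powr \<beta> * (R * y j \<omega> + e j)) \<longlonglongrightarrow> 0"
      using tendsto_add[OF tendsto_mult_right_zero[OF elim(3), of R] e_lim]
      by (simp add: algebra_simps)
    then show ?case
      unfolding d_def[symmetric]
    proof (rule tendsto_0_of_block_bounds[OF L_pos, rotated 3])
      show "d ((c + j) * L + k) \<le> R * y j \<omega> + e j" if "k < L" for j k
        using between[of k j] major[of j] that by simp
    qed (use beta y_nonneg e_nonneg in \<open>auto simp: d_def diam_nonneg R_def\<close>)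
  qed
qed

theorem lemma11:
  fixes M :: "'w measure"
    and F :: "nat \<Rightarrow> 'w measure"
    and W :: "nat \<Rightarrow> 'w \<Rightarrow> real^'n^'n"
    and x u :: "nat \<Rightarrow> 'w \<Rightarrow> real^'m^'n"
    and x0 :: "real^'m^'n"
    and t0 :: nat
    and \<gamma> \<beta>' q :: real
  assumes prob: "prob_space M"
    and filtration: "filtration (space M) F"
    and subalg: "\<forall>t. subalgebra M (F t)"
    and adapted: "\<forall>t. W t \<in> borel_measurable (F t)"
    and stochastic: "\<forall>t\<ge>t0. AE \<omega> in M. row_stochastic (W t \<omega>)"
    and gamma: "0 < \<gamma>" "\<gamma> < 1"
    and self_loops: "\<forall>t\<ge>t0. AE \<omega> in M. \<forall>i. (i, i) \<in> edges \<gamma> (W t \<omega>)"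
    and rooted: "\<exists>B>0. \<forall>t\<ge>t0. AE \<omega> in M. has_spanning_rooted_tree (block_edges \<gamma> M F W B t \<omega>)"
    and u_random: "\<forall>t\<ge>t0. u t \<in> borel_measurable M"
    and x_init: "\<forall>\<omega>\<in>space M. x t0 \<omega> = x0"
    and x_step: "\<forall>t\<ge>t0. \<forall>\<omega>\<in>space M. x (Suc t) \<omega> = W (Suc t) \<omega> ** x t \<omega> + u t \<omega>"
    and beta': "\<beta>' > 0"
    and q: "q \<ge> 0"
    and u_bound: "\<forall>t\<ge>t0. t > 0 \<longrightarrow> (AE \<omega> in M. diam (u t \<omega>) < q * real t powr (- \<beta>'))"
  shows "\<forall>\<beta><\<beta>'. AE \<omega> in M. (\<lambda>t. diam (x t \<omega>) * real t powr \<beta>) \<longlonglongrightarrow> 0"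
proof (intro allI impI)
  fix \<beta> :: real assume "\<beta> < \<beta>'"
  obtain B where B: "0 < B"
    "\<And>t. t0 \<le> t \<Longrightarrow> AE \<omega> in M. has_spanning_rooted_tree (block_edges \<gamma> M F W B t \<omega>)"
    using rooted by blast
  interpret prob_space M by (rule prob)
  interpret filtration "space M" F by (rule filtration)
  interpret rooted_blocks M F W \<gamma> B t0
    by unfold_locales (use subalg adapted stochastic gamma self_loops B in auto)
  \<comment> \<open>A negative exponent is reduced to exponent 0, which is still below
    \<open>\<beta>'\<close>; for \<open>t\<close> at least 1 the larger exponent gives the larger
    power.\<close>
  have "AE \<omega> in M. (\<lambda>t. diam (x t \<omega>) * real t powr max \<beta> 0) \<longlonglongrightarrow> 0"
    using x_step beta' \<open>\<beta> < \<beta>'\<close> q u_bound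
    by (intro perturbed_consensus[where u = u and q = q and \<beta>' = \<beta>']) auto
  then show "AE \<omega> in M. (\<lambda>t. diam (x t \<omega>) * real t powr \<beta>) \<longlonglongrightarrow> 0"
  proof eventually_elim
    case (elim \<omega>)
    have "eventually (\<lambda>t. norm (diam (x t \<omega>) * real t powr \<beta>)
        \<le> diam (x t \<omega>) * real t powr max \<beta> 0) sequentially"
      using eventually_ge_at_top[of 1]
      by eventually_elim (auto simp: abs_mult diam_nonneg intro!: mult_left_mono powr_mono)
    then show ?case using elim by (rule Lim_null_comparison)
  qed
qed

end
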